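(* Let $\beta\in(1,3/2]$ and let $T_\beta$ and $L_\beta$ be the greedy and lazy maps on $S_\beta$ defined in the context. Then $T_\beta$ admits an invariant probability measure absolutely continuous with respect to Lebesgue measure on $S_\beta$, and so does $L_\beta$.
   Context: Let $\vec q_0=(0,0)$, $\vec q_1=(1,0)$, $\vec q_2=(0,1)$, $f_{\vec q_i}(\vec z)=(\vec z+\vec q_i)/\beta$. $S_\beta$ is the attractor of this IFS; for $1<\beta\le3/2$ it is the closed triangle with vertices $(0,0)$, $(\frac1{\beta-1},0)$, $(0,\frac1{\beta-1})$. Subsets of $S_\beta$: $E_0=[0,\frac1\beta)\times[0,\frac1\beta)$; $E_1=\{0\le y<\frac1\beta,\ \frac{1}{\beta(\beta-1)}<x+y\le\frac{1}{\beta-1}\}$; $E_2=\{0\le x<\frac1\beta,\ \frac{1}{\beta(\beta-1)}<x+y\le\frac{1}{\beta-1}\}$; $C_{01}=\{x\ge\frac1\beta,\ 0\le y<\frac1\beta,\ x+y\le\frac{1}{\beta(\beta-1)}\}$; $C_{12}=\{x\ge\frac1\beta,\ y\ge\frac1\beta,\ \frac{1}{\beta(\beta-1)}<x+y\le\frac{1}{\beta-1}\}$; $C_{02}=\{0\le x<\frac1\beta,\ y\ge\frac1\beta,\ x+y\le\frac{1}{\beta(\beta-1)}\}$; $C_{012}=\{x\ge\frac1\beta,\ y\ge\frac1\beta,\ x+y\le\frac{1}{\beta(\beta-1)}\}$. Greedy map: $T_\beta(\vec z)=\beta\vec z$ on $E_0$, $\beta\vec z-\vec q_1$ on $C_{01}\cup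 E_1$, $\beta\vec z-\vec q_2$ on $C_{012}\cup C_{12}\cup C_{02}\cup E_2$. Lazy map: $L_\beta(\vec z)=\beta\vec z$ on $C_{012}\cup C_{01}\cup C_{02}\cup E_0$, $\beta\vec z-\vec q_1$ on $C_{12}\cup E_1$, $\beta\vec z-\vec q_2$ on $E_2$. *)

theory Defs
  imports "HOL-Analysis.Analysis" "HOL-Probability.Probability"
begin

type_synonym pt = "real \<times> real"

definition S_beta :: "real \<Rightarrow> pt set" where
  "S_beta b = {(x, y). 0 \<le> x \<and> 0 \<le> y \<and> x + y \<le> 1 / (b - 1)}"

definition E0 :: "real \<Rightarrow> pt set" where
  "E0 b = {(x, y). 0 \<le> x \<and> x < 1/b \<and> 0 \<le> y \<and> y < 1/b}"

definition E1 :: "real \<Rightarrow> pt set" where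
  "E1 b = {(x, y). 0 \<le> y \<and> y < 1/b \<and> 1/(b*(b-1)) < x + y \<and> x + y \<le> 1/(b-1)}"

definition E2 :: "real \<Rightarrow> pt set" where
  "E2 b = {(x, y). 0 \<le> x \<and> x < 1/b \<and> 1/(b*(b-1)) < x + y \<and> x + y \<le> 1/(b-1)}"

definition C01 :: "real \<Rightarrow> pt set" where
  "C01 b = {(x, y). x \<ge> 1/b \<and> 0 \<le> y \<and> y < 1/b \<and> x + y \<le> 1/(b*(b-1))}"

definition C12 :: "real \<Rightarrow> pt set" where
  "C12 b = {(x, y). x \<ge> 1/b \<and> y \<ge> 1/b \<and> 1/(b*(b-1)) < x + y \<and> x + y \<le> 1/(b-1)}"

definition C02 :: "real \<Rightarrow> pt set" where
  "C02 b = {(x, y). 0 \<le> x \<and> x < 1/b \<and> y \<ge> 1/b \<and> x + y \<le> 1/(b*(b-1))}"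

definition C012 :: "real \<Rightarrow> pt set" where
  "C012 b = {(x, y). x \<ge> 1/b \<and> y \<ge> 1/b \<and> x + y \<le> 1/(b*(b-1))}"

text \<open>Digits q0 = (0,0), q1 = (1,0), q2 = (0,1).  The maps are specified on the
  regions (which partition S_beta); outside these regions they are set to the identity
  (irrelevant, since only the restriction to S_beta matters).\<close>

definition greedy :: "real \<Rightarrow> pt \<Rightarrow> pt" where
  "greedy b z = (let (x, y) = z in
     if z \<in> E0 b then (b*x, b*y)
     else if z \<in> C01 b \<union> E1 b then (b*x - 1, b*y)
     else if z \<in> C012 b \<union> C12 b \<union> C02 b \<union> E2 b then (b*x, b*y - 1)
     else z)"

definition lazy :: "real \<Rightarrow> pt \<Rightarrow> pt" where
  "lazy b z = (let (x, y) = z in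
     if z \<in> C012 b \<union> C01 b \<union> C02 b \<union> E0 b then (b*x, b*y)
     else if z \<in> C12 b \<union> E1 b then (b*x - 1, b*y)
     else if z \<in> E2 b then (b*x, b*y - 1)
     else z)"

definition leb_S :: "real \<Rightarrow> pt measure" where
  "leb_S b = restrict_space lborel (S_beta b)"

definition has_acim :: "real \<Rightarrow> (pt \<Rightarrow> pt) \<Rightarrow> bool" where
  "has_acim b f \<longleftrightarrow> (\<exists>\<mu>. sets \<mu> = sets (leb_S b) \<and> prob_space \<mu> \<and>
      absolutely_continuous (leb_S b) \<mu> \<and> f \<in> measurable \<mu> \<mu> \<and>
      (\<forall>A \<in> sets \<mu>. emeasure \<mu> (f -` A \<inter> space \<mu>) = emeasure \<mu> A))"

end

theory Submission
  imports Defs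
begin

text \<open>On the triangle the greedy map is the skew product \<open>greedy_skew\<close>, all of whose discontinuity lines are
  parallel to the axes. Pushing Lebesgue measure on a box \<open>[0,a) \<times> [0,b)\<close> forward gives \<open>\<beta>\<^sup>-\<^sup>2\<close> times a
  sum of Lebesgue measures on three such boxes, so the mass performs a Markov chain on boxes. Start
  it at the unit box and remove the mass that returns there along the first branch: an
  explicit Lyapunov function shows that the expected return time is finite, and hence the sum of the
  densities over one excursion is an integrable invariant density (all removed mass adds up to the
  unit box from which the chain started). The lazy map is conjugate to the greedy one by an affine
  area-preserving involution of the triangle.\<close>

section \<open>Corner boxes, the skew product and the bookkeeping of one excursion\<close>

text \<open>Half-open sides make the images of the pieces of a box boxes of the same kind pointwise,
  not only up to null sets.\<close>

definition corner_box :: "real \<Rightarrow> real \<Rightarrow> pt set" where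
  "corner_box a b = {0..<a} \<times> {0..<b}"

lemma corner_box_measurable [measurable]: "corner_box a b \<in> sets borel"
  unfolding corner_box_def by (intro borel_Times) auto

lemma emeasure_corner_box:
  assumes "0 \<le> a" "0 \<le> b"
  shows "emeasure lborel (corner_box a b) = ennreal (a*b)"
proof -
  have "emeasure lborel (corner_box a b) = emeasure (lborel \<Otimes>\<^sub>M lborel) ({0..<a} \<times> {0..<b})"
    by (simp add: lborel_prod corner_box_def)
  also have "\<dots> = ennreal (a*b)"
    using assms by (simp add: lborel.emeasure_pair_measure_Times ennreal_mult)
  finally show ?thesis .
qed

text \<open>The digit is chosen with priority q2, q1, q0. The second coordinate evolves on its own,
  by the one-dimensional greedy map, hence a skew product. The formula is total and Borel on the
  plane; it is meant to agree with \<open>greedy\<close> on the triangle only.\<close>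

definition greedy_skew :: "real \<Rightarrow> pt \<Rightarrow> pt" where
  "greedy_skew \<beta> z = (if 1/\<beta> \<le> snd z then (\<beta> * fst z, \<beta> * snd z - 1)
     else if 1/\<beta> \<le> fst z then (\<beta> * fst z - 1, \<beta> * snd z)
     else (\<beta> * fst z, \<beta> * snd z))"

lemma greedy_skew_measurable [measurable]: "greedy_skew \<beta> \<in> borel_measurable borel"
  unfolding greedy_skew_def borel_prod [symmetric] by measurable

text \<open>The branch \<open>1/\<beta> \<le> a \<and> 1/\<beta> \<le> b\<close> is the one whose first child is the unit box; there the mass is
  removed instead of being propagated, and \<open>return_coeff\<close> below records the removed coefficient. Boxes with
  a nonpositive side are empty, and so are all their children.\<close>
primrec excursion_density :: "real \<Rightarrow> nat \<Rightarrow> real \<Rightarrow> real \<Rightarrow> pt \<Rightarrow> ennreal" where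
  "excursion_density \<beta> 0 = (\<lambda>a b. indicator (corner_box a b))"
| "excursion_density \<beta> (Suc n) = (\<lambda>a b z. ennreal (1/\<beta>^2) *
     ((if 1/\<beta> \<le> a \<and> 1/\<beta> \<le> b then 0 else excursion_density \<beta> n (min (\<beta>*a) 1) (min (\<beta>*b) 1) z)
      + excursion_density \<beta> n (\<beta>*a - 1) (min (\<beta>*b) 1) z + excursion_density \<beta> n (\<beta>*a) (\<beta>*b - 1) z))"

primrec return_coeff :: "real \<Rightarrow> nat \<Rightarrow> real \<Rightarrow> real \<Rightarrow> ennreal" where
  "return_coeff \<beta> 0 = (\<lambda>a b. if 1/\<beta> \<le> a \<and> 1/\<beta> \<le> b then ennreal (1/\<beta>^2) else 0)"
| "return_coeff \<beta> (Suc n) = (\<lambda>a b. ennreal (1/\<beta>^2) *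
     ((if 1/\<beta> \<le> a \<and> 1/\<beta> \<le> b then 0 else return_coeff \<beta> n (min (\<beta>*a) 1) (min (\<beta>*b) 1))
      + return_coeff \<beta> n (\<beta>*a - 1) (min (\<beta>*b) 1) + return_coeff \<beta> n (\<beta>*a) (\<beta>*b - 1)))"

lemma excursion_density_measurable [measurable]: "excursion_density \<beta> n a b \<in> borel_measurable borel"
proof (induction n arbitrary: a b)
  case (Suc n)
  note Suc [measurable]
  show ?case by simp
qed simp

section \<open>Affine changes of variables in the plane\<close>

lemma nn_integral_lborel_pt:
  fixes f :: "pt \<Rightarrow> ennreal"
  assumes [measurable]: "f \<in> borel_measurable borel"
  shows "(\<integral>\<^sup>+z. f z \<partial>lborel) = (\<integral>\<^sup>+x. \<integral>\<^sup>+y. f (x, y) \<partial>lborel \<partial>lborel)"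
proof -
  have "(\<integral>\<^sup>+z. f z \<partial>lborel) = (\<integral>\<^sup>+z. f z \<partial>(lborel \<Otimes>\<^sub>M lborel))"
    by (simp add: lborel_prod)
  also have "\<dots> = (\<integral>\<^sup>+x. \<integral>\<^sup>+y. f (x, y) \<partial>lborel \<partial>lborel)"
    by (rule lborel.nn_integral_fst [symmetric]) (simp add: lborel_prod)
  finally show ?thesis .
qed

lemma nn_integral_scale_translate:
  fixes f :: "pt \<Rightarrow> ennreal"
  assumes [measurable]: "f \<in> borel_measurable borel" and "0 < c"
  shows "(\<integral>\<^sup>+z. f (c * fst z - s, c * snd z - t) \<partial>lborel) = ennreal (1/c^2) * (\<integral>\<^sup>+z. f z \<partial>lborel)"
proof -
  have m1: "(\<lambda>(x, y). f (x, y)) \<in> borel_measurable (lborel \<Otimes>\<^sub>M lborel)"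
    by (simp add: lborel_prod)
  have m2 [measurable]: "(\<lambda>x. \<integral>\<^sup>+y. f (x, y) \<partial>lborel) \<in> borel_measurable borel"
    using lborel.borel_measurable_nn_integral [OF m1] by simp
  have m3: "(\<lambda>z. f (c * fst z - s, c * snd z - t)) \<in> borel_measurable borel"
    unfolding borel_prod [symmetric] by measurable
  have fy: "(\<lambda>y. f (x, y)) \<in> borel_measurable borel" for x
    by measurable
  have A: "(\<integral>\<^sup>+u. k u \<partial>lborel) = ennreal c * (\<integral>\<^sup>+x. k (c*x - q) \<partial>lborel)"
    if "k \<in> borel_measurable borel" for k :: "real \<Rightarrow> ennreal" and q
    using nn_integral_real_affine [OF that, of c "-q"] \<open>0 < c\<close> by simp
  \<comment> \<open>Multiplied by \<open>c^2\<close>, the identity follows by Tonelli: each of the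
    two coordinate integrals absorbs one factor \<open>c\<close>.\<close>
  have "ennreal (c^2) * (\<integral>\<^sup>+z. f (c * fst z - s, c * snd z - t) \<partial>lborel)
      = ennreal c * (ennreal c * (\<integral>\<^sup>+x. \<integral>\<^sup>+y. f (c * x - s, c * y - t) \<partial>lborel \<partial>lborel))"
    using \<open>0 < c\<close> by (simp add: nn_integral_lborel_pt [OF m3] power2_eq_square ennreal_mult mult.assoc)
  also have "ennreal c * (\<integral>\<^sup>+x. \<integral>\<^sup>+y. f (c * x - s, c * y - t) \<partial>lborel \<partial>lborel)
      = (\<integral>\<^sup>+x. ennreal c * (\<integral>\<^sup>+y. f (c * x - s, c * y - t) \<partial>lborel) \<partial>lborel)"
  proof (rule nn_integral_cmult [symmetric])
    have "(\<lambda>(x, y). f (c * x - s, c * y - t)) \<in> borel_measurable (lborel \<Otimes>\<^sub>M lborel)"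
      using m3 by (simp add: lborel_prod case_prod_beta)
    from lborel.borel_measurable_nn_integral [OF this]
    show "(\<lambda>x. \<integral>\<^sup>+y. f (c * x - s, c * y - t) \<partial>lborel) \<in> borel_measurable lborel"
      by simp
  qed
  also have "\<dots> = (\<integral>\<^sup>+x. \<integral>\<^sup>+y. f (c * x - s, y) \<partial>lborel \<partial>lborel)"
    by (intro nn_integral_cong A [symmetric] fy)
  also have "ennreal c * \<dots> = (\<integral>\<^sup>+x. \<integral>\<^sup>+y. f (x, y) \<partial>lborel \<partial>lborel)"
    by (rule A [OF m2, symmetric])
  also have "\<dots> = (\<integral>\<^sup>+z. f z \<partial>lborel)"
    by (simp add: nn_integral_lborel_pt)
  finally have "ennreal (1/c^2) * (ennreal (c^2) * (\<integral>\<^sup>+z. f (c * fst z - s, c * snd z - t) \<partial>lborel))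
     = ennreal (1/c^2) * (\<integral>\<^sup>+z. f z \<partial>lborel)" by simp
  moreover have "ennreal (1/c^2) * ennreal (c^2) = 1"
    using \<open>0 < c\<close> by (simp add: ennreal_mult [symmetric])
  ultimately show ?thesis by (simp add: mult.assoc [symmetric])
qed

text \<open>For fixed x the map is a reflection of the vertical line, which preserves
  length.\<close>

lemma nn_integral_shear:
  fixes f :: "pt \<Rightarrow> ennreal"
  assumes [measurable]: "f \<in> borel_measurable borel"
  shows "(\<integral>\<^sup>+z. f (fst z, c - fst z - snd z) \<partial>lborel) = (\<integral>\<^sup>+z. f z \<partial>lborel)"
proof -
  have m: "(\<lambda>z. f (fst z, c - fst z - snd z)) \<in> borel_measurable borel"
    unfolding borel_prod [symmetric] by measurable
  have fy: "(\<lambda>y. f (x, y)) \<in> borel_measurable borel" for x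
    by measurable
  have "(\<integral>\<^sup>+y. f (x, y) \<partial>lborel) = (\<integral>\<^sup>+y. f (x, c - x - y) \<partial>lborel)" for x
    using nn_integral_real_affine [OF fy, of "-1" x "c - x"] by simp
  then show ?thesis
    by (simp add: nn_integral_lborel_pt [OF m] nn_integral_lborel_pt [OF assms])
qed

section \<open>Transport of box densities by the skew product\<close>

text \<open>Each branch is affine with Jacobian \<open>\<beta>^2\<close>, and it sends the
  breakpoint 1/beta to 0 or 1, so the three pieces of a box are mapped onto corner boxes.\<close>

lemma transfer_corner_box:
  fixes g :: "pt \<Rightarrow> ennreal"
  assumes [measurable]: "g \<in> borel_measurable borel" and \<beta>: "1 < \<beta>"
  shows "(\<integral>\<^sup>+z. g (greedy_skew \<beta> z) * indicator (corner_box a b) z \<partial>lborel) = ennreal (1/\<beta>^2) *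
     ((\<integral>\<^sup>+z. g z * indicator (corner_box (min (\<beta>*a) 1) (min (\<beta>*b) 1)) z \<partial>lborel)
      + (\<integral>\<^sup>+z. g z * indicator (corner_box (\<beta>*a - 1) (min (\<beta>*b) 1)) z \<partial>lborel)
      + (\<integral>\<^sup>+z. g z * indicator (corner_box (\<beta>*a) (\<beta>*b - 1)) z \<partial>lborel))" (is "_ = _ * (?I1 + ?I2 + ?I3)")
proof -
  define k1 where "k1 z = g z * indicator (corner_box (min (\<beta>*a) 1) (min (\<beta>*b) 1)) z" for z
  define k2 where "k2 z = g z * indicator (corner_box (\<beta>*a - 1) (min (\<beta>*b) 1)) z" for z
  define k3 where "k3 z = g z * indicator (corner_box (\<beta>*a) (\<beta>*b - 1)) z" for z
  have [measurable]: "k1 \<in> borel_measurable borel" "k2 \<in> borel_measurable borel" "k3 \<in> borel_measurable borel"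
    unfolding k1_def k2_def k3_def by measurable
  have m: "(\<lambda>z. k (\<beta> * fst z - s, \<beta> * snd z - t)) \<in> borel_measurable lborel"
    if [measurable]: "k \<in> borel_measurable borel" for k :: "pt \<Rightarrow> ennreal" and s t
    unfolding measurable_lborel2 borel_prod [symmetric] by measurable
  have ineq: "1/\<beta> \<le> x \<longleftrightarrow> 1 \<le> \<beta>*x" "(x < a' \<longleftrightarrow> \<beta>*x < \<beta>*a')" "0 \<le> \<beta>*x \<longleftrightarrow> 0 \<le> x" for x a' :: real
    using \<beta> by (auto simp: field_simps zero_le_mult_iff)
  \<comment> \<open>Only the summand of the branch in force can be nonzero: under a wrong branch
    some coordinate of the image is negative, or is at least 1 where the box is capped at 1.\<close>
  have "g (greedy_skew \<beta> z) * indicator (corner_box a b) z = k1 (\<beta> * fst z - 0, \<beta> * snd z - 0)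
      + k2 (\<beta> * fst z - 1, \<beta> * snd z - 0) + k3 (\<beta> * fst z - 0, \<beta> * snd z - 1)" for z
    using ineq(2)[of "fst z" a] ineq(2)[of "snd z" b] ineq(3)[of "fst z"] ineq(3)[of "snd z"]
    unfolding greedy_skew_def k1_def k2_def k3_def corner_box_def ineq(1)
    by (cases z) (auto simp: indicator_def)
  then have "(\<integral>\<^sup>+z. g (greedy_skew \<beta> z) * indicator (corner_box a b) z \<partial>lborel)
     = (\<integral>\<^sup>+z. k1 (\<beta> * fst z - 0, \<beta> * snd z - 0) \<partial>lborel)
      + (\<integral>\<^sup>+z. k2 (\<beta> * fst z - 1, \<beta> * snd z - 0) \<partial>lborel) + (\<integral>\<^sup>+z. k3 (\<beta> * fst z - 0, \<beta> * snd z - 1) \<partial>lborel)"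
    by (simp only: nn_integral_add m borel_measurable_add \<open>k1 \<in> _\<close> \<open>k2 \<in> _\<close> \<open>k3 \<in> _\<close>)
  also have "\<dots> = ennreal (1/\<beta>^2) * ((\<integral>\<^sup>+z. k1 z \<partial>lborel) + (\<integral>\<^sup>+z. k2 z \<partial>lborel) + (\<integral>\<^sup>+z. k3 z \<partial>lborel))"
    using \<beta> by (subst (1 2 3) nn_integral_scale_translate) (simp_all add: distrib_left)
  finally show ?thesis by (simp add: k1_def k2_def k3_def)
qed

text \<open>One more step of the dynamics either moves the mass to the next generation or returns it
  to the unit box. Both recursions split off the first step from the box (a,b), so the induction
  must range over all boxes.\<close>

lemma transfer_excursion_density:
  fixes g :: "pt \<Rightarrow> ennreal"
  assumes g [measurable]: "g \<in> borel_measurable borel" and \<beta>: "1 < \<beta>"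
  shows "(\<integral>\<^sup>+z. g (greedy_skew \<beta> z) * excursion_density \<beta> n a b z \<partial>lborel)
     = (\<integral>\<^sup>+z. g z * excursion_density \<beta> (Suc n) a b z \<partial>lborel)
       + return_coeff \<beta> n a b * (\<integral>\<^sup>+z. g z * indicator (corner_box 1 1) z \<partial>lborel)"
proof (induction n arbitrary: a b)
  have step: "(\<integral>\<^sup>+z. f z * excursion_density \<beta> (Suc n) a b z \<partial>lborel) = ennreal (1/\<beta>^2) *
     ((if 1/\<beta> \<le> a \<and> 1/\<beta> \<le> b then 0 else \<integral>\<^sup>+z. f z * excursion_density \<beta> n (min (\<beta>*a) 1) (min (\<beta>*b) 1) z \<partial>lborel)
      + (\<integral>\<^sup>+z. f z * excursion_density \<beta> n (\<beta>*a - 1) (min (\<beta>*b) 1) z \<partial>lborel)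
      + (\<integral>\<^sup>+z. f z * excursion_density \<beta> n (\<beta>*a) (\<beta>*b - 1) z \<partial>lborel))"
    if [measurable]: "f \<in> borel_measurable borel" for f n a b
  proof -
    have "(\<integral>\<^sup>+z. f z * excursion_density \<beta> (Suc n) a b z \<partial>lborel) = (\<integral>\<^sup>+z. ennreal (1/\<beta>^2) *
     ((if 1/\<beta> \<le> a \<and> 1/\<beta> \<le> b then 0 else f z * excursion_density \<beta> n (min (\<beta>*a) 1) (min (\<beta>*b) 1) z)
      + f z * excursion_density \<beta> n (\<beta>*a - 1) (min (\<beta>*b) 1) z + f z * excursion_density \<beta> n (\<beta>*a) (\<beta>*b - 1) z) \<partial>lborel)"
      by (intro nn_integral_cong) (simp add: distrib_left mult_ac)
    then show ?thesis
      by (cases "1/\<beta> \<le> a \<and> 1/\<beta> \<le> b") (auto simp: nn_integral_cmult nn_integral_add simp del: excursion_density.simps)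
  qed
  {
    case 0
    \<comment> \<open>When the first child is killed it is exactly the unit box, which accounts for
      the returned term.\<close>
    have "min (\<beta>*a) 1 = 1" "min (\<beta>*b) 1 = 1" if "1/\<beta> \<le> a \<and> 1/\<beta> \<le> b"
      using that \<beta> by (simp_all add: field_simps)
    then show ?case
      unfolding step [OF g] using transfer_corner_box [OF g \<beta>, of a b]
      by (auto simp: distrib_left add_ac)
  next
    case (Suc n)
    have [measurable]: "(\<lambda>z. g (greedy_skew \<beta> z)) \<in> borel_measurable borel" by measurable
    show ?case
      unfolding step [OF g] step [OF \<open>(\<lambda>z. g (greedy_skew \<beta> z)) \<in> _\<close>] Suc.IH
      by (simp add: distrib_left distrib_right mult_ac add_ac step [OF g])
  }
qed


section \<open>A Lyapunov function on boxes\<close>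

text \<open>A drift inequality for the killed chain with running cost the area of the box. Iterating
  it bounds the mass of an excursion started at the box (a,b) by \<open>\<Phi> a b\<close>.\<close>

lemma exists_lyapunov:
  fixes \<beta> :: real
  assumes \<beta>: "1 < \<beta>"
  obtains \<Phi> :: "real \<Rightarrow> real \<Rightarrow> real"
  where "\<And>a b. 0 \<le> \<Phi> a b" and "\<And>a b. a \<le> 0 \<or> b \<le> 0 \<Longrightarrow> \<Phi> a b = 0"
    and "\<And>a b. 0 < a \<Longrightarrow> 0 < b \<Longrightarrow> a \<le> 1/(\<beta>-1) \<Longrightarrow> b \<le> 1 \<Longrightarrow>
      a * b + 1/\<beta>^2 * ((if 1/\<beta> \<le> a \<and> 1/\<beta> \<le> b then 0 else \<Phi> (min (\<beta>*a) 1) (min (\<beta>*b) 1))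
        + \<Phi> (\<beta>*a - 1) (min (\<beta>*b) 1) + \<Phi> (\<beta>*a) (\<beta>*b - 1)) \<le> \<Phi> a b"
proof -
  \<comment> \<open>\<open>p0\<close> is the product of (beta-1)/beta and 1/beta, the least
    fractions of the sides \<open>\<beta>*a\<close> and \<open>\<beta>*b\<close> that survive
    capping at 1. Halving it in \<open>\<kappa>\<close> lets the killed case pay for the term with
    \<open>2*\<kappa>\<close>. \<open>\<delta>\<close> makes \<open>(1 - 1/\<beta>)*(a+b)\<close>
    dominate \<open>3*(a*b)\<close> once a side is below \<open>\<delta>\<close>.\<close>
  define p0 where "p0 = (\<beta> - 1)/\<beta>^2"
  define \<kappa> where "\<kappa> = p0/2"
  define \<delta> where "\<delta> = (1 - 1/\<beta>)/3"
  have "p0 \<le> 1"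
    using \<beta> unfolding p0_def by (simp add: field_simps) (smt (verit) self_le_power zero_less_numeral)
  then have pos: "0 < p0" "0 < \<kappa>" "\<kappa> \<le> 1" "0 < \<delta>" "\<delta> < 1"
    using \<beta> by (auto simp: p0_def \<kappa>_def \<delta>_def field_simps)
  \<comment> \<open>The growth \<open>\<beta>^p\<close> of \<open>g\<close> has to beat the area
    share \<open>p0\<close> by a factor of two.\<close>
  obtain p where "2/p0 < \<beta>^p"
    using real_arch_pow [OF \<beta>] by blast
  then have p: "2 \<le> p0 * \<beta>^p"
    using pos by (simp add: field_simps)
  \<comment> \<open>If both sides are at least \<open>\<delta>\<close>, then \<open>g\<close> is at
    least \<open>(\<delta>*\<delta>)^p\<close>, and this \<open>D\<close> gives
    \<open>D*\<kappa>*g a b\<close> the value 3 or more.\<close>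
  define D where "D = 3/(\<kappa> * (\<delta>*\<delta>)^p)"
  have D: "0 < D" using pos by (simp add: D_def)
  \<comment> \<open>Since \<open>a + b\<close> is \<open>a b (1/a + 1/b)\<close>, the term \<open>a + b\<close> contracts along the dynamics up to a multiple
    of the area, which settles thin boxes. For the others, \<open>g\<close> grows by the factor \<open>\<beta>^p\<close> in the first
    child until the box is killed, so that the last term strictly decreases. The first child
    receives at least the fraction \<open>p0\<close> of the mass.\<close>
  define g where "g a b = (min a 1 * min b 1)^p" for a b :: real
  define \<Phi> where "\<Phi> a b = (if a \<le> 0 \<or> b \<le> 0 then 0 else a + b + D * (a * b) * (1 - \<kappa> * g a b))"
    for a b :: real
  have g: "0 \<le> g a b" "g a b \<le> 1" if "0 < a" "0 < b" for a b
    using that unfolding g_def by (auto intro!: power_le_one mult_le_one)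
  have \<kappa>g: "0 \<le> \<kappa> * g a b" "\<kappa> * g a b \<le> 1" if "0 < a" "0 < b" for a b
    using g [OF that] pos by (auto intro!: mult_le_one)
  have upper: "\<Phi> a b \<le> a + b + D * (a * b)" if "0 < a" "0 < b" for a b
    using that D \<kappa>g [OF that] by (simp add: \<Phi>_def mult_left_le)
  show ?thesis
  proof
    show "0 \<le> \<Phi> a b" for a b
      using D \<kappa>g [of a b] by (auto simp: \<Phi>_def)
    show "\<Phi> a b = 0" if "a \<le> 0 \<or> b \<le> 0" for a b
      using that by (simp add: \<Phi>_def)
    fix a b :: real
    assume a: "0 < a" and b: "0 < b" and aB: "a \<le> 1/(\<beta>-1)" and b1: "b \<le> 1"
    define A1 where "A1 = min (\<beta>*a) 1"
    define B1 where "B1 = min (\<beta>*b) 1"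
    define A2 where "A2 = max (\<beta>*a - 1) 0"
    define B2 where "B2 = max (\<beta>*b - 1) 0"
    have sums: "A1 + A2 = \<beta>*a" "B1 + B2 = \<beta>*b"
      by (auto simp: A1_def A2_def B1_def B2_def)
    have P: "0 < A1" "0 < B1" "A1 \<le> 1" "B1 \<le> 1" "0 \<le> A2" "0 \<le> B2" "B1 \<le> \<beta>*b"
      using a b \<beta> by (auto simp: A1_def A2_def B1_def B2_def)
    have ab: "0 < a*b" "0 < \<beta>*a" "0 < \<beta>*b" using a b \<beta> by auto
    \<comment> \<open>This child repeats the side \<open>B1\<close> of the first child. It is
      nonempty only if \<open>\<beta>*a > 1\<close>, and then the repeated side is at most the area
      \<open>\<beta>^2*(a*b)\<close>. \<open>s3\<close> treats the repeated side
      \<open>\<beta>*a\<close> alike.\<close>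
    have s2: "\<Phi> (\<beta>*a - 1) B1 \<le> A2 + \<beta>^2*(a*b) + D*(A2*B1)"
    proof (cases "\<beta>*a \<le> 1")
      case True
      then show ?thesis using P ab D by (simp add: \<Phi>_def)
    next
      case False
      have "B1 \<le> (\<beta>*a)*(\<beta>*b)"
        using False P ab by (smt (verit) mult_le_cancel_right1)
      then show ?thesis
        using False upper [of "\<beta>*a-1" B1] P by (simp add: A2_def power2_eq_square mult_ac)
    qed
    have s3: "\<Phi> (\<beta>*a) (\<beta>*b - 1) \<le> B2 + \<beta>^2*(a*b) + D*(\<beta>*a*B2)"
    proof (cases "\<beta>*b \<le> 1")
      case True
      then show ?thesis using P ab D by (simp add: \<Phi>_def)
    next
      case False
      have "\<beta>*a \<le> (\<beta>*a)*(\<beta>*b)"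
        using False ab mult_left_mono [of 1 "\<beta>*b" "\<beta>*a"] by simp
      then show ?thesis
        using False upper [of "\<beta>*a" "\<beta>*b-1"] ab by (simp add: B2_def power2_eq_square mult_ac)
    qed
    have "(\<beta>-1)*a \<le> 1" using aB \<beta> by (simp add: field_simps)
    moreover have "(\<beta>-1)/\<beta> \<le> 1" using \<beta> by simp
    ultimately have "(\<beta>-1)/\<beta> * (\<beta>*a) \<le> A1"
      using \<beta> ab mult_right_mono [of "(\<beta>-1)/\<beta>" 1 "\<beta>*a"] by (simp add: A1_def)
    moreover have "1/\<beta> * (\<beta>*b) \<le> B1"
      using \<beta> b b1 by (simp add: B1_def)
    ultimately have "((\<beta>-1)/\<beta> * (\<beta>*a)) * (1/\<beta> * (\<beta>*b)) \<le> A1 * B1"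
      using P \<beta> a b by (intro mult_mono) auto
    then have p0: "p0 * (\<beta>^2*(a*b)) \<le> A1 * B1"
      using \<beta> by (simp add: p0_def power2_eq_square mult_ac)
    \<comment> \<open>In the killed case the left side is 0 and it suffices that the bracket is
      nonnegative. Otherwise the growth of \<open>g\<close> must produce the factor 2.\<close>
    have s1: "(if 1/\<beta> \<le> a \<and> 1/\<beta> \<le> b then 0 else \<Phi> A1 B1)
       \<le> A1 + B1 + D * (A1*B1 - 2*\<kappa>*g a b*(\<beta>^2*(a*b)))"
    proof (cases "1/\<beta> \<le> a \<and> 1/\<beta> \<le> b")
      case True
      have "2*\<kappa>*g a b*(\<beta>^2*(a*b)) \<le> 2*\<kappa>*1*(\<beta>^2*(a*b))"
        using g [OF a b] pos ab by (intro mult_left_mono mult_right_mono) auto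
      also have "\<dots> \<le> A1*B1" using p0 by (simp add: \<kappa>_def)
      finally show ?thesis using True D P by simp
    next
      case False
      \<comment> \<open>Without killing, some side is below 1/beta and is stretched by the full
        factor, while the other capped side does not shrink.\<close>
      have "\<beta> * (min a 1 * min b 1) \<le> A1 * B1"
      proof (cases "1/\<beta> \<le> a")
        case True
        then have "A1 = 1" "B1 = \<beta>*b" using False \<beta> by (auto simp: A1_def B1_def field_simps)
        moreover have "min a 1 * min b 1 \<le> 1 * b" using a b by (intro mult_mono) auto
        ultimately show ?thesis using \<beta> by simp
      next
        case False
        then have "A1 = \<beta>*a" using \<beta> by (auto simp: A1_def field_simps)
        moreover have "min b 1 \<le> B1" 
          using \<beta> b mult_right_mono [of 1 \<beta> b] unfolding B1_def by linarith
        then have "min a 1 * min b 1 \<le> a * B1" using a b by (intro mult_mono) auto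
        ultimately show ?thesis using \<beta> by simp
      qed
      then have "(\<beta> * (min a 1 * min b 1))^p \<le> (A1*B1)^p"
        using \<beta> a b by (intro power_mono) auto
      then have g1: "\<beta>^p * g a b \<le> g A1 B1"
        using P by (simp add: g_def power_mult_distrib)
      have "2 * (g a b * (\<beta>^2*(a*b))) \<le> (p0 * \<beta>^p) * (g a b * (\<beta>^2*(a*b)))"
        using p g [OF a b] ab by (intro mult_right_mono) auto
      also have "\<dots> = (\<beta>^p * g a b) * (p0 * (\<beta>^2*(a*b)))" by (simp add: mult_ac)
      also have "\<dots> \<le> g A1 B1 * (A1*B1)"
        using mult_mono [OF g1 p0] g(1) [OF P(1,2)] pos ab by simp
      finally have "\<kappa> * (2 * (g a b * (\<beta>^2*(a*b)))) \<le> \<kappa> * (g A1 B1 * (A1*B1))"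
        using pos by simp
      then have "D * (A1*B1 - \<kappa> * (g A1 B1 * (A1*B1))) \<le> D * (A1*B1 - \<kappa> * (2 * (g a b * (\<beta>^2*(a*b)))))"
        using D by simp
      moreover have "\<Phi> A1 B1 = A1 + B1 + D * (A1*B1 - \<kappa> * (g A1 B1 * (A1*B1)))"
        using P by (simp add: \<Phi>_def algebra_simps)
      ultimately show ?thesis
        unfolding if_not_P [OF False] by (simp add: mult_ac)
    qed
    have "A1*B1 + A2*B1 + \<beta>*a*B2 = (A1 + A2)*B1 + \<beta>*a*B2" by (simp add: distrib_right)
    also have "\<dots> = (\<beta>*a)*(B1 + B2)" unfolding sums(1) by (simp only: distrib_left)
    also have "\<dots> = \<beta>^2*(a*b)" unfolding sums(2) by (simp add: power2_eq_square mult_ac)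
    finally have area: "A1*B1 + A2*B1 + \<beta>*a*B2 = \<beta>^2*(a*b)" .
    have "(if 1/\<beta> \<le> a \<and> 1/\<beta> \<le> b then 0 else \<Phi> A1 B1) + \<Phi> (\<beta>*a - 1) B1 + \<Phi> (\<beta>*a) (\<beta>*b - 1)
        \<le> (A1 + A2) + (B1 + B2) + 2*(\<beta>^2*(a*b))
          + D * ((A1*B1 + A2*B1 + \<beta>*a*B2) - 2*\<kappa>*g a b*(\<beta>^2*(a*b)))"
      using s1 s2 s3 by (simp add: algebra_simps)
    also have "\<dots> = \<beta>^2 * ((a + b)/\<beta> + 2*(a*b) + D*(a*b)*(1 - 2*\<kappa>*g a b))"
      using \<beta> unfolding area sums by (simp add: field_simps power2_eq_square)
    finally have total: "1/\<beta>^2 * ((if 1/\<beta> \<le> a \<and> 1/\<beta> \<le> b then 0 else \<Phi> A1 B1)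
         + \<Phi> (\<beta>*a - 1) B1 + \<Phi> (\<beta>*a) (\<beta>*b - 1))
        \<le> (a + b)/\<beta> + 2*(a*b) + D*(a*b)*(1 - 2*\<kappa>*g a b)"
      using \<beta> by (simp add: field_simps)
    \<comment> \<open>Three areas have to be paid: the running cost and the two repeated sides. Thin
      boxes pay with the contraction of \<open>a + b\<close>, the others with the strict decrease of
      the last term.\<close>
    have drop: "3*(a*b) \<le> (1 - 1/\<beta>)*(a+b) + D*\<kappa>*g a b*(a*b)"
    proof (cases "\<delta> \<le> a \<and> \<delta> \<le> b")
      case True
      then have "(\<delta>*\<delta>)^p \<le> g a b"
        unfolding g_def using pos by (intro power_mono mult_mono) auto
      then have "3 \<le> D*\<kappa>*g a b"
        using pos by (simp add: D_def field_simps)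
      then have "3*(a*b) \<le> D*\<kappa>*g a b*(a*b)" using ab by (intro mult_right_mono) auto
      moreover have "0 \<le> (1 - 1/\<beta>)*(a+b)" using \<beta> a b by simp
      ultimately show ?thesis by simp
    next
      case False
      have "a*b \<le> \<delta>*(a+b)"
      proof (cases "\<delta> \<le> a")
        case True
        then have "b*a \<le> \<delta>*a" using False a by (intro mult_right_mono) auto
        then show ?thesis using pos b by (simp add: algebra_simps add_increasing2)
      next
        case False
        then have "a*b \<le> \<delta>*b" using b by (intro mult_right_mono) auto
        then show ?thesis using pos a by (simp add: algebra_simps add_increasing)
      qed
      then have "3*(a*b) \<le> (1 - 1/\<beta>)*(a+b)" by (simp add: \<delta>_def)
      moreover have "0 \<le> D*\<kappa>*g a b*(a*b)" using D pos ab g [OF a b] by simp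
      ultimately show ?thesis by simp
    qed
    have "a*b + ((a + b)/\<beta> + 2*(a*b) + D*(a*b)*(1 - 2*\<kappa>*g a b)) \<le> a + b + D*(a*b)*(1 - \<kappa>*g a b)"
      using drop by (simp add: algebra_simps add_divide_distrib)
    with total show "a * b + 1/\<beta>^2 * ((if 1/\<beta> \<le> a \<and> 1/\<beta> \<le> b then 0 else \<Phi> (min (\<beta>*a) 1) (min (\<beta>*b) 1))
        + \<Phi> (\<beta>*a - 1) (min (\<beta>*b) 1) + \<Phi> (\<beta>*a) (\<beta>*b - 1)) \<le> \<Phi> a b"
      using a b unfolding A1_def [symmetric] B1_def [symmetric] by (simp add: \<Phi>_def)
  qed
qed

section \<open>Support and total mass of an excursion\<close>

lemma excursion_density_eq_0: "1 < \<beta> \<Longrightarrow> a \<le> 0 \<or> b \<le> 0 \<Longrightarrow> excursion_density \<beta> n a b z = 0"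
proof (induction n arbitrary: a b)
  case 0
  then show ?case by (cases z) (auto simp: corner_box_def)
next
  case (Suc n)
  have *: "\<beta>*t \<le> 0" "min (\<beta>*t) 1 \<le> 0" "\<beta>*t \<le> 1" "\<not> 1/\<beta> \<le> t" if "t \<le> 0" for t
    using that \<open>1 < \<beta>\<close> mult_nonneg_nonpos [of \<beta> t]
    by (auto simp: not_le intro: le_less_trans)
  show ?case
    using Suc.prems(2) by (auto simp: Suc.IH [OF \<open>1 < \<beta>\<close>] *)
qed

text \<open>A box with \<open>a + b \<le> 1/(\<beta>-1)\<close> lies in the triangle, and its
  children inherit the bound: scaling raises it by exactly 1, which the digit removes again. The
  first child has sides at most 1, and 2 is at most 1/(beta-1) because beta is at most 3/2.\<close>

lemma excursion_density_eq_0_outside: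
  assumes \<beta>: "1 < \<beta>" "\<beta> \<le> 3/2" and z: "z \<notin> S_beta \<beta>"
  shows "a + b \<le> 1/(\<beta>-1) \<Longrightarrow> excursion_density \<beta> n a b z = 0"
proof (induction n arbitrary: a b)
  case 0
  then show ?case using z by (cases z) (auto simp: corner_box_def S_beta_def indicator_def)
next
  case (Suc n)
  have two: "2 \<le> 1/(\<beta>-1)" using \<beta> by (simp add: field_simps)
  have "\<beta>*(a+b) \<le> \<beta>*(1/(\<beta>-1))" using Suc.prems \<beta> by (intro mult_left_mono) auto
  also have "\<dots> = 1/(\<beta>-1) + 1" using \<beta> by (simp add: field_simps)
  finally have *: "\<beta>*a + \<beta>*b \<le> 1/(\<beta>-1) + 1" by (simp add: distrib_left)
  have "min (\<beta>*a) 1 + min (\<beta>*b) 1 \<le> 1/(\<beta>-1)" "\<beta>*a - 1 + min (\<beta>*b) 1 \<le> 1/(\<beta>-1)"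
    "\<beta>*a + (\<beta>*b - 1) \<le> 1/(\<beta>-1)"
    using * two by linarith+
  then show ?case by (simp add: Suc.IH)
qed

lemma excursion_density_total_mass:
  assumes \<beta>: "1 < \<beta>" "\<beta> \<le> 3/2"
  shows "(\<Sum>n. \<integral>\<^sup>+z. excursion_density \<beta> n 1 1 z \<partial>lborel) < \<infinity>"
proof -
  from exists_lyapunov [OF \<beta>(1)] obtain \<Phi> :: "real \<Rightarrow> real \<Rightarrow> real"
    where \<Phi>0: "\<And>a b. 0 \<le> \<Phi> a b" "\<And>a b. a \<le> 0 \<or> b \<le> 0 \<Longrightarrow> \<Phi> a b = 0"
    and \<Phi>: "\<And>a b. 0 < a \<Longrightarrow> 0 < b \<Longrightarrow> a \<le> 1/(\<beta>-1) \<Longrightarrow> b \<le> 1 \<Longrightarrow>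
      a * b + 1/\<beta>^2 * ((if 1/\<beta> \<le> a \<and> 1/\<beta> \<le> b then 0 else \<Phi> (min (\<beta>*a) 1) (min (\<beta>*b) 1))
        + \<Phi> (\<beta>*a - 1) (min (\<beta>*b) 1) + \<Phi> (\<beta>*a) (\<beta>*b - 1)) \<le> \<Phi> a b"
    by metis
  have two: "2 \<le> 1/(\<beta>-1)" using \<beta> by (simp add: field_simps)
  have box: "(\<integral>\<^sup>+z. excursion_density \<beta> 0 a b z \<partial>lborel) = ennreal (a*b)" if "0 < a" "0 < b" for a b
    using that by (simp add: emeasure_corner_box)
  \<comment> \<open>The bound is uniform in n. Both side conditions pass to the children, so the
    induction can use the drift inequality at every box met.\<close>
  have "(\<Sum>k<n. \<integral>\<^sup>+z. excursion_density \<beta> k a b z \<partial>lborel) \<le> ennreal (\<Phi> a b)"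
    if "a + b \<le> 1/(\<beta>-1)" "b \<le> 1" for n a b
    using that
  proof (induction n arbitrary: a b)
    case (Suc n)
    show ?case
    proof (cases "a \<le> 0 \<or> b \<le> 0")
      case True
      then show ?thesis by (simp add: excursion_density_eq_0 [OF \<beta>(1) True] del: excursion_density.simps)
    next
      case False
      then have a: "0 < a" and b: "0 < b" by auto
      let ?c = "1/\<beta> \<le> a \<and> 1/\<beta> \<le> b"
      let ?S = "\<lambda>a b. \<Sum>k<n. \<integral>\<^sup>+z. excursion_density \<beta> k a b z \<partial>lborel"
      have "\<beta>*(a+b) \<le> \<beta>*(1/(\<beta>-1))" using Suc.prems \<beta> by (intro mult_left_mono) auto
      also have "\<dots> = 1/(\<beta>-1) + 1" using \<beta> by (simp add: field_simps)
      finally have *: "\<beta>*a + \<beta>*b \<le> 1/(\<beta>-1) + 1" by (simp add: distrib_left)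
      have "\<beta>*b \<le> \<beta>*1" using Suc.prems \<beta> by (intro mult_left_mono) auto
      then have **: "\<beta>*b - 1 \<le> 1" using \<beta> by linarith
      have IH: "?S (min (\<beta>*a) 1) (min (\<beta>*b) 1) \<le> ennreal (\<Phi> (min (\<beta>*a) 1) (min (\<beta>*b) 1))"
        "?S (\<beta>*a - 1) (min (\<beta>*b) 1) \<le> ennreal (\<Phi> (\<beta>*a - 1) (min (\<beta>*b) 1))"
        "?S (\<beta>*a) (\<beta>*b - 1) \<le> ennreal (\<Phi> (\<beta>*a) (\<beta>*b - 1))"
        using * ** two by (intro Suc.IH; linarith)+
      have "(\<integral>\<^sup>+z. excursion_density \<beta> (Suc k) a b z \<partial>lborel) = ennreal (1/\<beta>^2) *
        ((if ?c then 0 else \<integral>\<^sup>+z. excursion_density \<beta> k (min (\<beta>*a) 1) (min (\<beta>*b) 1) z \<partial>lborel)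
        + (\<integral>\<^sup>+z. excursion_density \<beta> k (\<beta>*a - 1) (min (\<beta>*b) 1) z \<partial>lborel)
        + (\<integral>\<^sup>+z. excursion_density \<beta> k (\<beta>*a) (\<beta>*b - 1) z \<partial>lborel))" for k
        by (cases ?c) (auto simp: nn_integral_cmult nn_integral_add)
      \<comment> \<open>Generation 0 contributes the area; the later ones are the earlier
        generations of the children.\<close>
      then have "(\<Sum>k<Suc n. \<integral>\<^sup>+z. excursion_density \<beta> k a b z \<partial>lborel) = ennreal (a*b) + ennreal (1/\<beta>^2) *
        ((if ?c then 0 else ?S (min (\<beta>*a) 1) (min (\<beta>*b) 1)) + ?S (\<beta>*a - 1) (min (\<beta>*b) 1) + ?S (\<beta>*a) (\<beta>*b - 1))"
        unfolding sum.lessThan_Suc_shift box [OF a b]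
        by (cases ?c) (auto simp: sum_distrib_left [symmetric] sum.distrib simp del: excursion_density.simps)
      also have "\<dots> \<le> ennreal (a*b) + ennreal (1/\<beta>^2) *
        (ennreal (if ?c then 0 else \<Phi> (min (\<beta>*a) 1) (min (\<beta>*b) 1)) + ennreal (\<Phi> (\<beta>*a - 1) (min (\<beta>*b) 1))
         + ennreal (\<Phi> (\<beta>*a) (\<beta>*b - 1)))"
        using IH by (intro add_mono mult_left_mono order_refl) auto
      also have "\<dots> = ennreal (a * b + 1/\<beta>^2 * ((if ?c then 0 else \<Phi> (min (\<beta>*a) 1) (min (\<beta>*b) 1))
        + \<Phi> (\<beta>*a - 1) (min (\<beta>*b) 1) + \<Phi> (\<beta>*a) (\<beta>*b - 1)))"
        using a b \<Phi>0(1) \<beta> by (simp add: ennreal_plus [symmetric] ennreal_mult [symmetric] del: ennreal_plus)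
      also have "\<dots> \<le> ennreal (\<Phi> a b)"
        using Suc.prems a b by (intro ennreal_leI \<Phi>) auto
      finally show ?thesis .
    qed
  qed simp
  then have "(\<Sum>k<n. \<integral>\<^sup>+z. excursion_density \<beta> k 1 1 z \<partial>lborel) \<le> ennreal (\<Phi> 1 1)" for n
    using two by simp
  then have "(\<Sum>n. \<integral>\<^sup>+z. excursion_density \<beta> n 1 1 z \<partial>lborel) \<le> ennreal (\<Phi> 1 1)"
    by (intro suminf_le_const) auto
  then show ?thesis by (simp add: le_less_trans)
qed

section \<open>The invariant density\<close>

lemma exists_invariant_density:
  assumes \<beta>: "1 < \<beta>" "\<beta> \<le> 3/2"
  obtains h :: "pt \<Rightarrow> ennreal" where "h \<in> borel_measurable borel" "\<And>z. z \<notin> S_beta \<beta> \<Longrightarrow> h z = 0"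
    "(\<integral>\<^sup>+z. h z \<partial>lborel) = 1"
    "\<And>g :: pt \<Rightarrow> ennreal. g \<in> borel_measurable borel \<Longrightarrow>
      (\<integral>\<^sup>+z. g (greedy_skew \<beta> z) * h z \<partial>lborel) = (\<integral>\<^sup>+z. g z * h z \<partial>lborel)"
proof -
  define h where "h z = (\<Sum>n. excursion_density \<beta> n 1 1 z)" for z
  have hm [measurable]: "h \<in> borel_measurable borel" unfolding h_def by measurable
  \<comment> \<open>\<open>R\<close> is the total coefficient returned to the unit box,
    \<open>I\<close> integrates over generation 0 and \<open>J\<close> over all later generations.
    Then \<open>h\<close> integrates to I + J, and its push-forward to J + R I.\<close>
  define R where "R = (\<Sum>n. return_coeff \<beta> n 1 1)"
  define J where "J g = (\<Sum>n. \<integral>\<^sup>+z. g z * excursion_density \<beta> (Suc n) 1 1 z \<partial>lborel)" for g :: "pt \<Rightarrow> ennreal"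
  define I where "I g = (\<integral>\<^sup>+z. g z * indicator (corner_box 1 1) z \<partial>lborel)" for g :: "pt \<Rightarrow> ennreal"
  have sum_int: "(\<integral>\<^sup>+z. g z * h z \<partial>lborel) = (\<Sum>n. \<integral>\<^sup>+z. g z * excursion_density \<beta> n 1 1 z \<partial>lborel)"
    if [measurable]: "g \<in> borel_measurable borel" for g
    unfolding h_def by (simp add: nn_integral_suminf [symmetric] ennreal_suminf_cmult del: excursion_density.simps)
  have hI: "(\<integral>\<^sup>+z. g z * h z \<partial>lborel) = I g + J g" if "g \<in> borel_measurable borel" for g
    using suminf_offset [OF summableI, of "\<lambda>n. \<integral>\<^sup>+z. g z * excursion_density \<beta> n 1 1 z \<partial>lborel" 1]
    unfolding sum_int [OF that] I_def J_def by (simp add: add.commute del: excursion_density.simps(2))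
  have hT: "(\<integral>\<^sup>+z. g (greedy_skew \<beta> z) * h z \<partial>lborel) = J g + R * I g"
    if [measurable]: "g \<in> borel_measurable borel" for g
  proof -
    have "(\<lambda>z. g (greedy_skew \<beta> z)) \<in> borel_measurable borel" by measurable
    from sum_int [OF this] show ?thesis
      unfolding transfer_excursion_density [OF that \<beta>(1)] I_def J_def R_def
      by (simp only: suminf_add [OF summableI summableI, symmetric] ennreal_suminf_multc)
  qed
  have I1: "I (\<lambda>_. 1) = 1" by (simp add: I_def emeasure_corner_box)
  define m where "m = (\<integral>\<^sup>+z. h z \<partial>lborel)"
  have m: "m = 1 + J (\<lambda>_. 1)" "m = J (\<lambda>_. 1) + R"
    using hI [of "\<lambda>_. 1"] hT [of "\<lambda>_. 1"] by (simp_all add: I1 m_def)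
  have fin: "m < \<infinity>"
    using sum_int [of "\<lambda>_. 1"] excursion_density_total_mass [OF \<beta>] by (simp add: m_def)
  \<comment> \<open>Mass is conserved, so 1 + J = J + R for the constant function 1; finiteness
    permits cancelling J.\<close>
  then have R: "R = 1"
    using m by (metis add.commute ennreal_add_left_cancel ennreal_add_eq_top infinity_ennreal_def less_irrefl)
  have inv: "(\<integral>\<^sup>+z. g (greedy_skew \<beta> z) * h z \<partial>lborel) = (\<integral>\<^sup>+z. g z * h z \<partial>lborel)"
    if "g \<in> borel_measurable borel" for g
    using hI [OF that] hT [OF that] by (simp add: R add.commute)
  have m0: "m \<noteq> 0" using m(1) by simp
  show ?thesis
  proof
    show "(\<lambda>z. h z / m) \<in> borel_measurable borel" by measurable
    show "h z / m = 0" if "z \<notin> S_beta \<beta>" for z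
    proof -
      have "(1::real) + 1 \<le> 1/(\<beta>-1)" using \<beta> by (simp add: field_simps)
      then show ?thesis using excursion_density_eq_0_outside [OF \<beta> that] by (simp add: h_def)
    qed
    show "(\<integral>\<^sup>+z. h z / m \<partial>lborel) = 1"
      using fin m0 by (simp add: nn_integral_divide m_def [symmetric])
    show "(\<integral>\<^sup>+z. g (greedy_skew \<beta> z) * (h z / m) \<partial>lborel) = (\<integral>\<^sup>+z. g z * (h z / m) \<partial>lborel)"
      if [measurable]: "g \<in> borel_measurable borel" for g
    proof -
      have "(\<integral>\<^sup>+z. f z * (h z / m) \<partial>lborel) = (\<integral>\<^sup>+z. f z * h z \<partial>lborel) / m"
        if [measurable]: "f \<in> borel_measurable borel" for f
        by (simp add: nn_integral_divide [symmetric] ennreal_times_divide)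
      then show ?thesis using inv [OF that] by simp
    qed
  qed
qed


section \<open>From an invariant density to an invariant measure\<close>

text \<open>Invariance is checked on the whole plane for a Borel map \<open>F\<close> agreeing with
  \<open>f\<close> on the triangle; testing with indicators gives the statement about sets.\<close>

lemma has_acimI:
  fixes h :: "pt \<Rightarrow> ennreal"
  assumes h [measurable]: "h \<in> borel_measurable borel" and h0: "\<And>z. z \<notin> S_beta \<beta> \<Longrightarrow> h z = 0"
    and h1: "(\<integral>\<^sup>+z. h z \<partial>lborel) = 1"
    and F [measurable]: "F \<in> borel_measurable borel" and FS: "\<And>z. z \<in> S_beta \<beta> \<Longrightarrow> F z \<in> S_beta \<beta>"
    and inv: "\<And>g :: pt \<Rightarrow> ennreal. g \<in> borel_measurable borel \<Longrightarrow>
      (\<integral>\<^sup>+z. g (F z) * h z \<partial>lborel) = (\<integral>\<^sup>+z. g z * h z \<partial>lborel)"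
    and f: "\<And>z. z \<in> S_beta \<beta> \<Longrightarrow> f z = F z"
  shows "has_acim \<beta> f"
proof -
  have "S_beta \<beta> = {z. 0 \<le> fst z} \<inter> {z. 0 \<le> snd z} \<inter> {z. fst z + snd z \<le> 1/(\<beta>-1)}"
    by (auto simp: S_beta_def)
  moreover have "closed \<dots>"
    by (intro closed_Int closed_Collect_le continuous_intros)
  ultimately have S [measurable]: "S_beta \<beta> \<in> sets borel" by simp
  define \<mu> where "\<mu> = density (leb_S \<beta>) h"
  have sp: "space \<mu> = S_beta \<beta>" by (simp add: \<mu>_def leb_S_def space_restrict_space)
  have hL: "h \<in> borel_measurable (leb_S \<beta>)"
    unfolding leb_S_def by (intro measurable_restrict_space1) simp
  have sets: "sets \<mu> = sets (restrict_space borel (S_beta \<beta>))"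
    by (simp add: \<mu>_def leb_S_def cong: sets_restrict_space_cong)
  have setsD: "A \<in> sets borel \<and> A \<subseteq> S_beta \<beta>" if "A \<in> sets \<mu>" for A
    using that unfolding sets by (simp add: sets_restrict_space_iff)
  have em: "emeasure \<mu> A = (\<integral>\<^sup>+z. indicator A z * h z \<partial>lborel)" if A: "A \<in> sets \<mu>" for A
  proof -
    have "emeasure \<mu> A = (\<integral>\<^sup>+z. h z * indicator A z \<partial>leb_S \<beta>)"
      using A unfolding \<mu>_def by (intro emeasure_density hL) simp
    also have "\<dots> = (\<integral>\<^sup>+z. h z * indicator A z * indicator (S_beta \<beta>) z \<partial>lborel)"
      unfolding leb_S_def by (rule nn_integral_restrict_space) simp
    also have "\<dots> = (\<integral>\<^sup>+z. indicator A z * h z \<partial>lborel)"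
      using setsD [OF A] by (intro nn_integral_cong) (auto simp: indicator_def)
    finally show ?thesis .
  qed
  have "f \<in> measurable (restrict_space borel (S_beta \<beta>)) (restrict_space borel (S_beta \<beta>))"
  proof (rule measurable_restrict_space2)
    show "f \<in> space (restrict_space borel (S_beta \<beta>)) \<rightarrow> S_beta \<beta>"
      using FS f by (auto simp: space_restrict_space)
    have "F \<in> measurable (restrict_space borel (S_beta \<beta>)) borel"
      by (intro measurable_restrict_space1 F)
    then show "f \<in> measurable (restrict_space borel (S_beta \<beta>)) borel"
      by (subst measurable_cong [of _ f F]) (auto simp: space_restrict_space f)
  qed
  then have fm: "f \<in> measurable \<mu> \<mu>"
    using measurable_cong_sets [OF sets sets] by simp
  show ?thesis
    unfolding has_acim_def
  proof (intro exI [of _ \<mu>] conjI ballI)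
    show "sets \<mu> = sets (leb_S \<beta>)" by (simp add: \<mu>_def)
    have "(\<integral>\<^sup>+z. indicator (S_beta \<beta>) z * h z \<partial>lborel) = (\<integral>\<^sup>+z. h z \<partial>lborel)"
      using h0 by (intro nn_integral_cong) (auto simp: indicator_def)
    then show "prob_space \<mu>"
      using em [OF sets.top] h1 by (intro prob_spaceI) (simp add: sp)
    show "absolutely_continuous (leb_S \<beta>) \<mu>"
      unfolding \<mu>_def by (rule absolutely_continuousI_density [OF hL])
    show "f \<in> measurable \<mu> \<mu>" by (rule fm)
    fix A assume A: "A \<in> sets \<mu>"
    have [measurable]: "A \<in> sets borel" using setsD [OF A] by simp
    have "emeasure \<mu> (f -` A \<inter> space \<mu>) = (\<integral>\<^sup>+z. indicator A (F z) * h z \<partial>lborel)"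
      unfolding em [OF measurable_sets [OF fm A]]
    proof (rule nn_integral_cong)
      show "indicator (f -` A \<inter> space \<mu>) z * h z = indicator A (F z) * h z" for z
        by (cases "z \<in> S_beta \<beta>") (simp_all add: sp f h0 indicator_def)
    qed
    also have "\<dots> = emeasure \<mu> A"
      using inv [of "indicator A"] em [OF A] by simp
    finally show "emeasure \<mu> (f -` A \<inter> space \<mu>) = emeasure \<mu> A" .
  qed
qed

section \<open>The greedy and lazy maps on the triangle\<close>

lemma greedy_skew_mem_S_beta:
  assumes \<beta>: "1 < \<beta>" "\<beta> \<le> 3/2" and z: "z \<in> S_beta \<beta>"
  shows "greedy_skew \<beta> z \<in> S_beta \<beta>"
proof -
  obtain x y where xy: "z = (x, y)" "0 \<le> x" "0 \<le> y" "x + y \<le> 1/(\<beta>-1)"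
    using z by (auto simp: S_beta_def)
  have "\<beta>*(x+y) \<le> \<beta>*(1/(\<beta>-1))" using xy \<beta> by (intro mult_left_mono) auto
  also have "\<dots> = 1/(\<beta>-1) + 1" using \<beta> by (simp add: field_simps)
  finally have "\<beta>*x + \<beta>*y \<le> 1/(\<beta>-1) + 1" by (simp add: distrib_left)
  moreover have "2 \<le> 1/(\<beta>-1)" using \<beta> by (simp add: field_simps)
  moreover have "0 \<le> \<beta>*x" "0 \<le> \<beta>*y" using xy \<beta> by auto
  moreover have "1/\<beta> \<le> t \<longleftrightarrow> 1 \<le> \<beta>*t" for t using \<beta> by (simp add: field_simps)
  ultimately show ?thesis by (auto simp: xy(1) greedy_skew_def S_beta_def)
qed

text \<open>Makes the comparisons with the diagonal line linear in 1/(beta-1) and 1/beta.\<close>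

lemma inner_line_eq:
  fixes \<beta> :: real
  assumes "1 < \<beta>"
  shows "1/(\<beta>*(\<beta>-1)) = 1/(\<beta>-1) - 1/\<beta>"
  using assms by (simp add: field_simps)

text \<open>Since beta is at most 3/2, 3/beta is at most 1/(beta-1), so the square \<open>E0\<close>
  lies below the diagonal line. Hence x exceeds 1/beta on \<open>E1\<close> and y does on
  \<open>E2\<close>, and the diagonal never affects the greedy digit.\<close>

lemma greedy_eq_greedy_skew:
  assumes \<beta>: "1 < \<beta>" "\<beta> \<le> 3/2" and z: "z \<in> S_beta \<beta>"
  shows "greedy \<beta> z = greedy_skew \<beta> z"
proof -
  have "3/\<beta> \<le> 1/(\<beta>-1)" using \<beta> by (simp add: field_simps)
  then have "3 * (1/\<beta>) \<le> 1/(\<beta>-1)" by simp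
  moreover obtain x y where "z = (x, y)" by (cases z)
  ultimately show ?thesis
    using z unfolding greedy_def greedy_skew_def E0_def E1_def E2_def C01_def C12_def C02_def C012_def
      S_beta_def inner_line_eq [OF \<beta>(1)]
    by (auto simp: Let_def simp del: divide_le_eq_1 divide_less_eq_1)
qed

text \<open>\<open>flip\<close> replaces \<open>y\<close> by the third barycentric coordinate of the triangle, which turns the
  diagonal discontinuity line of the lazy map into a horizontal one.\<close>
definition flip :: "real \<Rightarrow> pt \<Rightarrow> pt" where
  "flip \<beta> z = (fst z, 1/(\<beta>-1) - fst z - snd z)"

lemma flip_flip: "flip \<beta> (flip \<beta> z) = z"
  by (cases z) (simp add: flip_def)

lemma flip_mem_S_beta: "z \<in> S_beta \<beta> \<Longrightarrow> flip \<beta> z \<in> S_beta \<beta>"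
  by (auto simp: flip_def S_beta_def)

lemma flip_measurable [measurable]: "flip \<beta> \<in> borel_measurable borel"
  unfolding flip_def borel_prod [symmetric] by measurable

lemma nn_integral_flip:
  fixes f :: "pt \<Rightarrow> ennreal"
  assumes "f \<in> borel_measurable borel"
  shows "(\<integral>\<^sup>+z. f (flip \<beta> z) \<partial>lborel) = (\<integral>\<^sup>+z. f z \<partial>lborel)"
  unfolding flip_def by (rule nn_integral_shear [OF assms])

text \<open>After the flip, the condition that y is at least 1/beta says that the point lies on or
  below the diagonal line. The conjugation swaps the digits q0 and q2 and fixes q1.\<close>

lemma lazy_eq_flip_greedy_skew:
  assumes \<beta>: "1 < \<beta>" "\<beta> \<le> 3/2" and z: "z \<in> S_beta \<beta>"
  shows "lazy \<beta> z = flip \<beta> (greedy_skew \<beta> (flip \<beta> z))"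
proof -
  define c where "c = 1/(\<beta>-1)"
  define d where "d = 1/\<beta>"
  have "3/\<beta> \<le> c" using \<beta> by (simp add: field_simps c_def)
  then have cd: "3 * d \<le> c" by (simp add: d_def)
  \<comment> \<open>This identity turns the digit subtracted in the flipped coordinate into the lazy
    digit.\<close>
  have \<beta>c: "\<beta> * c = c + 1" using \<beta> by (simp add: c_def field_simps)
  have line: "1/(\<beta>*(\<beta>-1)) = c - d"
    unfolding c_def d_def by (rule inner_line_eq [OF \<beta>(1)])
  obtain x y where xy: "z = (x, y)" "0 \<le> x" "0 \<le> y" "x + y \<le> c"
    using z by (auto simp: S_beta_def c_def)
  have "\<beta> * (c - x - y) = c + 1 - \<beta>*x - \<beta>*y" by (simp add: right_diff_distrib \<beta>c)
  then have "flip \<beta> (greedy_skew \<beta> (flip \<beta> z)) = (if x + y \<le> c - d then (\<beta>*x, \<beta>*y)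
      else if d \<le> x then (\<beta>*x - 1, \<beta>*y) else (\<beta>*x, \<beta>*y - 1))"
    by (auto simp: flip_def greedy_skew_def c_def [symmetric] d_def [symmetric] xy(1))
  moreover have "lazy \<beta> z = (if x + y \<le> c - d then (\<beta>*x, \<beta>*y)
      else if d \<le> x then (\<beta>*x - 1, \<beta>*y) else (\<beta>*x, \<beta>*y - 1))"
    using cd xy(2-)
    unfolding lazy_def E0_def E1_def E2_def C01_def C12_def C02_def C012_def
      line c_def [symmetric] d_def [symmetric] xy(1)
    by (auto simp: Let_def)
  ultimately show ?thesis by simp
qed

theorem theorem3p4:
  fixes \<beta> :: real
  assumes "1 < \<beta>" and "\<beta> \<le> 3/2"
  shows "has_acim \<beta> (greedy \<beta>) \<and> has_acim \<beta> (lazy \<beta>)"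
proof -
  from exists_invariant_density [OF assms] obtain h :: "pt \<Rightarrow> ennreal"
    where h [measurable]: "h \<in> borel_measurable borel" and h0: "\<And>z. z \<notin> S_beta \<beta> \<Longrightarrow> h z = 0"
      and h1: "(\<integral>\<^sup>+z. h z \<partial>lborel) = 1"
      and inv: "\<And>g :: pt \<Rightarrow> ennreal. g \<in> borel_measurable borel \<Longrightarrow>
        (\<integral>\<^sup>+z. g (greedy_skew \<beta> z) * h z \<partial>lborel) = (\<integral>\<^sup>+z. g z * h z \<partial>lborel)"
    by blast
  have "has_acim \<beta> (greedy \<beta>)"
    by (rule has_acimI [OF h h0 h1 greedy_skew_measurable _ inv])
      (auto intro: greedy_skew_mem_S_beta greedy_eq_greedy_skew assms)
  moreover have "has_acim \<beta> (lazy \<beta>)"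
  proof (rule has_acimI [of "\<lambda>z. h (flip \<beta> z)" \<beta> "\<lambda>z. flip \<beta> (greedy_skew \<beta> (flip \<beta> z))"])
    show "h (flip \<beta> z) = 0" if "z \<notin> S_beta \<beta>" for z
      using that flip_mem_S_beta [of "flip \<beta> z" \<beta>] by (auto simp: flip_flip intro: h0)
    show "(\<integral>\<^sup>+z. h (flip \<beta> z) \<partial>lborel) = 1"
      by (simp add: nn_integral_flip h1)
    fix g :: "pt \<Rightarrow> ennreal"
    assume [measurable]: "g \<in> borel_measurable borel"
    \<comment> \<open>Substituting the flip moves the integral to the greedy side, where
      \<open>h\<close> is invariant; a second flip moves it back.\<close>
    have "(\<integral>\<^sup>+z. g (flip \<beta> (greedy_skew \<beta> (flip \<beta> z))) * h (flip \<beta> z) \<partial>lborel)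
        = (\<integral>\<^sup>+z. g (flip \<beta> (greedy_skew \<beta> z)) * h z \<partial>lborel)"
      by (rule nn_integral_flip) measurable
    also have "\<dots> = (\<integral>\<^sup>+z. g (flip \<beta> z) * h z \<partial>lborel)"
      by (rule inv) measurable
    also have "\<dots> = (\<integral>\<^sup>+z. g z * h (flip \<beta> z) \<partial>lborel)"
      using nn_integral_flip [of "\<lambda>z. g z * h (flip \<beta> z)" \<beta>] by (simp add: flip_flip)
    finally show "(\<integral>\<^sup>+z. g (flip \<beta> (greedy_skew \<beta> (flip \<beta> z))) * h (flip \<beta> z) \<partial>lborel)
        = (\<integral>\<^sup>+z. g z * h (flip \<beta> z) \<partial>lborel)" .
  qed (auto intro: flip_mem_S_beta greedy_skew_mem_S_beta lazy_eq_flip_greedy_skew assms)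
  ultimately show ?thesis by blast
qed

end
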